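(* Let $f:\mathbb{R}^d\to\mathbb{R}$ be convex and $L$-Lipschitz, and let $\rho>0$. Then for all $x,y\in\mathbb{R}^d$ and $\delta\in(0,1)$, the matrix $\nabla^2 f_\rho(x)$ is an $(\epsilon_{\mathrm{add}},\epsilon_{\mathrm{mul}})$-approximation to $\nabla^2 f_\rho(y)$, for $$\epsilon_{\mathrm{mul}} := \frac{\|x-y\|^2}{\rho^2}+\frac{2\|x-y\|\sqrt{\log\frac1\delta}}{\rho},\qquad \epsilon_{\mathrm{add}}:=\frac{\sqrt2\,L\delta}{\rho}.$$
   Context: $\|\cdot\|$ is the Euclidean norm. For $\rho>0$, $f_\rho(x):=\mathbb{E}_{\xi\sim\mathcal{N}(0,\rho^2 I_d)}[f(x-\xi)]$ is the Gaussian convolution of $f$ (it is convex and twice differentiable when $f$ is convex and Lipschitz). For positive semidefinite $A,B\in\mathbb{R}^{d\times d}$, $A$ is an $(\epsilon_{\mathrm{add}},\epsilon_{\mathrm{mul}})$-approximation to $B$ if $A\preceq\exp(\epsilon_{\mathrm{mul}})B+\epsilon_{\mathrm{add}}I_d$ and $B\preceq\exp(\epsilon_{\mathrm{mul}})A+\epsilon_{\mathrm{add}}I_d$, where $\preceq$ is the Loewner order. *)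

theory Defs
  imports "HOL-Probability.Probability"
begin

(* Centred Gaussian N(0, \<sigma>^2 I) on R^d, \<sigma> > 0; since the covariance is a multiple of
   the identity, its density is the product of the univariate normal densities. *)
definition isotropic_gaussian :: "real \<Rightarrow> (real ^ 'd) measure" where
  "isotropic_gaussian \<sigma> =
     density lborel (\<lambda>\<xi>. ennreal (\<Prod>i\<in>UNIV. normal_density 0 \<sigma> (\<xi> $ i)))"

definition gaussian_convolution :: "real \<Rightarrow> (real ^ 'd \<Rightarrow> real) \<Rightarrow> real ^ 'd \<Rightarrow> real" where
  "gaussian_convolution \<rho> f x = (LINT \<xi>|isotropic_gaussian \<rho>. f (x - \<xi>))"

(* Total functions, with the intended meaning only at points of (twice) differentiability. *)
definition gradient :: "(real ^ 'd \<Rightarrow> real) \<Rightarrow> real ^ 'd \<Rightarrow> real ^ 'd" where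
  "gradient g x = (THE D. GDERIV g x :> D)"

definition hessian :: "(real ^ 'd \<Rightarrow> real) \<Rightarrow> real ^ 'd \<Rightarrow> real ^ 'd ^ 'd" where
  "hessian g x = jacobian (gradient g) (at x)"

definition positive_semidefinite :: "real ^ 'n ^ 'n \<Rightarrow> bool" where
  "positive_semidefinite A \<longleftrightarrow> transpose A = A \<and> (\<forall>v. 0 \<le> v \<bullet> (A *v v))"

definition loewner_le :: "real ^ 'n ^ 'n \<Rightarrow> real ^ 'n ^ 'n \<Rightarrow> bool" (infix "\<preceq>\<^sub>L" 50) where
  "A \<preceq>\<^sub>L B \<longleftrightarrow> positive_semidefinite (B - A)"

(* The relation is only meaningful between positive semidefinite matrices, so this is
   part of it. Scaling of matrices is *\<^sub>R: on matrices, * is componentwise. *)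
definition is_approximation ::
    "real \<Rightarrow> real \<Rightarrow> real ^ 'n ^ 'n \<Rightarrow> real ^ 'n ^ 'n \<Rightarrow> bool" where
  "is_approximation \<epsilon>_add \<epsilon>_mul A B \<longleftrightarrow>
     positive_semidefinite A \<and> positive_semidefinite B \<and>
     A \<preceq>\<^sub>L exp \<epsilon>_mul *\<^sub>R B + \<epsilon>_add *\<^sub>R mat 1 \<and>
     B \<preceq>\<^sub>L exp \<epsilon>_mul *\<^sub>R A + \<epsilon>_add *\<^sub>R mat 1"

end

theory Submission
  imports Defs
begin

text \<open>
  Write \<open>\<phi>\<close> for the Gaussian density of variance \<open>\<rho>\<^sup>2\<close> and \<open>f\<^sub>\<rho>\<close> for the Gaussian
  convolution of \<open>f\<close>. If \<open>f\<close> were smooth, the Hessian of \<open>f\<^sub>\<rho>\<close> at \<open>x\<close> would be the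
  average of the positive semidefinite Hessians of \<open>f\<close> at \<open>u\<close> with weight \<open>\<phi> (x - u)\<close>, so that
  comparing two Hessians of \<open>f\<^sub>\<rho>\<close> amounts to comparing two weights.

  Let \<open>D = \<parallel>x - y\<parallel>\<close>, let \<open>e\<close> be the direction from \<open>x\<close> to \<open>y\<close> and put
  \<open>t = sqrt (2 ln (1 / \<delta>))\<close>. The ratio \<open>\<phi> (x - u) / \<phi> (y - u)\<close> is at most
  \<open>exp (D\<^sup>2 / (2 \<rho>\<^sup>2) + D t / \<rho>)\<close> as long as \<open>e \<bullet> (x - u) \<le> \<rho> t\<close>. On the remaining half space,
  \<open>\<phi> (x - u)\<close> is at most \<open>exp (- t\<^sup>2 / 2) = \<delta>\<close> times the density of the Gaussian centred at
  \<open>x' = x - \<rho> t e\<close>. So one always has \<open>\<phi> (x - u) \<le> C \<phi> (y - u) + \<delta> \<phi> (x' - u)\<close>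
  (\<open>gaussian_density_le_translates\<close>), and the Hessian at \<open>x\<close> is at most \<open>C\<close> times the one at
  \<open>y\<close> plus \<open>\<delta>\<close> times the one at \<open>x'\<close>. The last one is bounded by a multiple of \<open>L / \<rho>\<close>, because
  \<open>f\<close> is \<open>L\<close>-Lipschitz and the total variation distance between two translates of the Gaussian is
  at most proportional to their distance divided by \<open>\<rho>\<close>
  (\<open>gaussian_convolution_bounded_diff_le\<close>). That \<open>\<epsilon>_mul\<close> is at least the exponent of \<open>C\<close> is simple
  arithmetic.

  Since \<open>f\<close> need not be smooth, second differences \<open>f (u + k) + f (u - k) - 2 f u\<close> take the role of
  its second derivatives. They are nonnegative by convexity and commute with the convolution
  (\<open>gaussian_convolution_second_difference\<close>), so the argument above applies to them verbatim, and
  dividing by \<open>h\<^sup>2\<close> for \<open>k = h v\<close>, \<open>h \<rightarrow> 0\<close>, gives the quadratic form of the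
  Hessian of \<open>f\<^sub>\<rho>\<close>. This requires that \<open>f\<^sub>\<rho>\<close> is twice differentiable, which follows from the
  identity \<open>\<phi> (x - u) = exp (- \<parallel>x\<parallel>\<^sup>2 / (2 \<rho>\<^sup>2)) exp (x \<bullet> u / \<rho>\<^sup>2) \<phi> u\<close>: up to an elementary
  factor, \<open>f\<^sub>\<rho>\<close> is the Laplace transform of \<open>f \<phi>\<close>, and such transforms can be differentiated
  under the integral sign as often as desired (\<open>laplace_transform_has_derivative\<close>).
\<close>

section \<open>The isotropic Gaussian density\<close>

definition gaussian_density :: "real \<Rightarrow> real ^ 'd \<Rightarrow> real" where
  "gaussian_density \<rho> w = (\<Prod>i\<in>UNIV. normal_density 0 \<rho> (w $ i))"

lemma gaussian_density_eq_exp: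
  "gaussian_density \<rho> (w :: real ^ 'd) =
     (1 / sqrt (2 * pi * \<rho>\<^sup>2)) ^ CARD('d) * exp (- (norm w)\<^sup>2 / (2 * \<rho>\<^sup>2))"
proof -
  have "(norm w)\<^sup>2 = (\<Sum>i\<in>UNIV. (w $ i)\<^sup>2)"
    by (simp add: norm_vec_def L2_set_def sum_nonneg)
  then show ?thesis
    unfolding gaussian_density_def normal_density_def prod.distrib
    by (simp add: exp_sum[symmetric] sum_negf sum_divide_distrib[symmetric])
qed

lemma gaussian_density_nonneg [simp]: "0 \<le> gaussian_density \<rho> w"
  by (simp add: gaussian_density_def prod_nonneg)

lemma gaussian_density_pos: "0 < \<rho> \<Longrightarrow> 0 < gaussian_density \<rho> w"
  by (simp add: gaussian_density_def prod_pos normal_density_pos)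

lemma measurable_gaussian_density [measurable]:
  "gaussian_density \<rho> \<in> borel_measurable borel"
  unfolding gaussian_density_eq_exp by measurable

lemma has_bochner_integral_gaussian_density:
  assumes "0 < \<rho>"
  shows "has_bochner_integral lborel (gaussian_density \<rho> :: real ^ 'd \<Rightarrow> real) 1"
proof (rule has_bochner_integral_nn_integral)
  have dens: "(\<integral>\<^sup>+ x. ennreal (normal_density 0 \<rho> x) \<partial>lborel) = 1"
    using assms by (simp add: nn_integral_eq_integral)
  have prod_Basis: "(\<Prod>b\<in>Basis. h (w \<bullet> b)) = (\<Prod>i\<in>UNIV. h (w $ i))"
    for h :: "real \<Rightarrow> real" and w :: "real ^ 'd"
  proof -
    have Basis: "Basis = range (\<lambda>i. axis i 1 :: real ^ 'd)"
      by (auto simp: Basis_vec_def)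
    have "inj (\<lambda>i. axis i 1 :: real ^ 'd)"
      by (simp add: inj_def axis_eq_axis)
    then show ?thesis
      unfolding Basis by (subst prod.reindex) (simp_all add: inner_axis)
  qed
  have "(\<integral>\<^sup>+ w. ennreal (gaussian_density \<rho> (w :: real ^ 'd)) \<partial>lborel)
      = (\<integral>\<^sup>+ w. (\<Prod>b\<in>Basis. ennreal (normal_density 0 \<rho> ((w :: real ^ 'd) \<bullet> b))) \<partial>lborel)"
    by (simp add: gaussian_density_def prod_Basis prod_ennreal)
  also have "\<dots> = (\<Prod>b\<in>(Basis :: (real ^ 'd) set). \<integral>\<^sup>+ x. ennreal (normal_density 0 \<rho> x) \<partial>lborel)"
    by (rule nn_integral_lborel_prod) auto
  also have "\<dots> = 1"
    by (simp only: dens prod.neutral_const)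
  finally show "(\<integral>\<^sup>+ w. ennreal (gaussian_density \<rho> (w :: real ^ 'd)) \<partial>lborel) = ennreal 1"
    by simp
qed auto

lemma lborel_integral_reflect:
  fixes f :: "'a :: euclidean_space \<Rightarrow> real"
  assumes [measurable]: "f \<in> borel_measurable borel"
  shows "(\<integral>u. f (x - u) \<partial>lborel) = (\<integral>u. f u \<partial>lborel)"
proof -
  have eq: "lborel = distr lborel borel (\<lambda>u. x - u)"
    using lborel_affine[of "-1" x] by (simp add: density_1)
  show ?thesis
    by (subst (2) eq) (simp add: integral_distr)
qed

section \<open>Differentiating Laplace transforms\<close>

text \<open>
  All exponential moments are required, rather than integrability near a given point, because the
  class is then closed under multiplication by linear functions. This is what differentiation of a
  Laplace transform does to the integrand, so a single lemma yields derivatives of any order.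
\<close>
definition exp_integrable :: "('a::euclidean_space \<Rightarrow> 'b::{banach,second_countable_topology}) \<Rightarrow> bool" where
  "exp_integrable g \<longleftrightarrow>
     g \<in> borel_measurable borel \<and> (\<forall>a. integrable lborel (\<lambda>u. exp (a * norm u) * norm (g u)))"

lemma exp_integrable_dominated:
  assumes "exp_integrable g" and [measurable]: "h \<in> borel_measurable borel"
    and le: "\<And>u. norm (h u) \<le> C * exp (a * norm u) * norm (g u)"
  shows "exp_integrable h"
  unfolding exp_integrable_def
proof (intro conjI allI)
  fix b
  have "integrable lborel (\<lambda>u. C * (exp ((b + a) * norm u) * norm (g u)))"
    using assms(1) by (simp add: exp_integrable_def)
  then show "integrable lborel (\<lambda>u. exp (b * norm u) * norm (h u))"
  proof (rule Bochner_Integration.integrable_bound)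
    show "AE u in lborel. norm (exp (b * norm u) * norm (h u))
        \<le> norm (C * (exp ((b + a) * norm u) * norm (g u)))"
    proof (rule AE_I2)
      fix u
      have "exp (b * norm u) * norm (h u) \<le> exp (b * norm u) * (C * exp (a * norm u) * norm (g u))"
        by (intro mult_left_mono le) simp
      also have "\<dots> = C * (exp ((b + a) * norm u) * norm (g u))"
        by (simp add: exp_add algebra_simps)
      finally show "norm (exp (b * norm u) * norm (h u)) 
          \<le> norm (C * (exp ((b + a) * norm u) * norm (g u)))"
        by simp
    qed
  qed measurable
qed fact

lemma norm_le_exp_norm: "norm u \<le> exp (norm u)"
  using exp_ge_add_one_self[of "norm u"] by linarith

lemma exp_integrable_scaleR_id:
  assumes "exp_integrable g"
  shows "exp_integrable (\<lambda>u. g u *\<^sub>R u)"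
proof (rule exp_integrable_dominated[OF assms, where C = 1 and a = 1])
  show "(\<lambda>u. g u *\<^sub>R u) \<in> borel_measurable borel"
    using assms by (auto simp: exp_integrable_def)
  show "norm (g u *\<^sub>R u) \<le> 1 * exp (1 * norm u) * norm (g u)" for u
    using mult_right_mono[OF norm_le_exp_norm[of u], of "norm (g u)"] by (simp add: mult.commute)
qed

lemma exp_integrable_inner_scaleR:
  assumes "exp_integrable g"
  shows "exp_integrable (\<lambda>u. (k \<bullet> u) *\<^sub>R g u)"
proof (rule exp_integrable_dominated[OF assms, where C = "norm k" and a = 1])
  show "(\<lambda>u. (k \<bullet> u) *\<^sub>R g u) \<in> borel_measurable borel"
    using assms by (auto simp: exp_integrable_def)
  show "norm ((k \<bullet> u) *\<^sub>R g u) \<le> norm k * exp (1 * norm u) * norm (g u)" for u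
    using order_trans[OF Cauchy_Schwarz_ineq2 mult_left_mono[OF norm_le_exp_norm[of u] norm_ge_zero[of k]]]
    by (auto intro!: mult_right_mono)
qed

lemma exp_integrable_imp_integrable:
  assumes "exp_integrable g"
  shows "integrable lborel (\<lambda>u. exp (h \<bullet> u) *\<^sub>R g u)"
proof (rule Bochner_Integration.integrable_bound)
  show "integrable lborel (\<lambda>u. exp (norm h * norm u) * norm (g u))"
    using assms by (simp add: exp_integrable_def)
  show "(\<lambda>u. exp (h \<bullet> u) *\<^sub>R g u) \<in> borel_measurable lborel"
    using assms by (auto simp: exp_integrable_def)
  show "AE u in lborel. norm (exp (h \<bullet> u) *\<^sub>R g u) \<le> norm (exp (norm h * norm u) * norm (g u))"
    by (auto intro!: mult_right_mono norm_cauchy_schwarz)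
qed

lemma abs_exp_minus_linear_le: "\<bar>exp z - 1 - z\<bar> \<le> exp \<bar>z\<bar> * z\<^sup>2" for z :: real
  using Taylor_exp_field[of z 1] by (simp add: algebra_simps power2_eq_square abs_mult_self_eq)

text \<open>
  The increment from \<open>h\<close> to \<open>h + k\<close> differs from its linear part by the integral of
  \<open>exp (h \<bullet> u) (exp (k \<bullet> u) - 1 - k \<bullet> u) g u\<close>. For \<open>\<parallel>k\<parallel> < 1\<close> the middle factor is at most
  \<open>\<parallel>k\<parallel>\<^sup>2 exp (3 \<parallel>u\<parallel>)\<close>, so the error is of order \<open>\<parallel>k\<parallel>\<^sup>2\<close>.
\<close>
lemma laplace_transform_has_derivative:
  fixes g :: "'a::euclidean_space \<Rightarrow> 'b::{banach,second_countable_topology}"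
  assumes g: "exp_integrable g"
  shows "((\<lambda>h. \<integral>u. exp (h \<bullet> u) *\<^sub>R g u \<partial>lborel) has_derivative
          (\<lambda>k. \<integral>u. exp (h \<bullet> u) *\<^sub>R (k \<bullet> u) *\<^sub>R g u \<partial>lborel)) (at h)"
proof -
  have [measurable]: "g \<in> borel_measurable borel"
    using g by (simp add: exp_integrable_def)
  have int0: "integrable lborel (\<lambda>u. exp (h \<bullet> u) *\<^sub>R g u)" for h
    by (rule exp_integrable_imp_integrable[OF g])
  have int1: "integrable lborel (\<lambda>u. exp (h \<bullet> u) *\<^sub>R (k \<bullet> u) *\<^sub>R g u)" for k
    by (intro exp_integrable_imp_integrable exp_integrable_inner_scaleR g)
  define C where "C = (\<integral>u. exp ((norm h + 3) * norm u) * norm (g u) \<partial>lborel)"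
  have remainder: "norm ((\<integral>u. exp (y \<bullet> u) *\<^sub>R g u \<partial>lborel) - (\<integral>u. exp (h \<bullet> u) *\<^sub>R g u \<partial>lborel)
        - (\<integral>u. exp (h \<bullet> u) *\<^sub>R ((y - h) \<bullet> u) *\<^sub>R g u \<partial>lborel)) / norm (y - h)
      \<le> C * norm (y - h)" if "y \<noteq> h" "dist y h < 1" for y
  proof -
    define k where "k = y - h"
    have k: "k \<noteq> 0" "norm k < 1" "y = h + k"
      using that by (auto simp: k_def dist_norm)
    have bound: "norm (exp (y \<bullet> u) *\<^sub>R g u - exp (h \<bullet> u) *\<^sub>R g u - exp (h \<bullet> u) *\<^sub>R (k \<bullet> u) *\<^sub>R g u)
        \<le> (norm k)\<^sup>2 * (exp ((norm h + 3) * norm u) * norm (g u))" for u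
    proof -
      have "exp (y \<bullet> u) *\<^sub>R g u - exp (h \<bullet> u) *\<^sub>R g u - exp (h \<bullet> u) *\<^sub>R (k \<bullet> u) *\<^sub>R g u
          = (exp (h \<bullet> u) * (exp (k \<bullet> u) - 1 - k \<bullet> u)) *\<^sub>R g u"
        by (simp add: k(3) inner_add_left exp_add algebra_simps)
      then have "norm (exp (y \<bullet> u) *\<^sub>R g u - exp (h \<bullet> u) *\<^sub>R g u - exp (h \<bullet> u) *\<^sub>R (k \<bullet> u) *\<^sub>R g u)
          = exp (h \<bullet> u) * \<bar>exp (k \<bullet> u) - 1 - k \<bullet> u\<bar> * norm (g u)"
        by (simp add: abs_mult)
      also have "\<dots> \<le> exp (norm h * norm u) * (exp (norm u) * (norm k * exp (norm u))\<^sup>2) * norm (g u)"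
      proof (intro mult_right_mono mult_mono)
        show "exp (h \<bullet> u) \<le> exp (norm h * norm u)"
          by (simp add: norm_cauchy_schwarz)
        have abs_le: "\<bar>k \<bullet> u\<bar> \<le> norm k * norm u"
          by (rule Cauchy_Schwarz_ineq2)
        also have "\<dots> \<le> norm k * exp (norm u)"
          by (intro mult_left_mono norm_le_exp_norm) simp
        finally have sq: "(k \<bullet> u)\<^sup>2 \<le> (norm k * exp (norm u))\<^sup>2"
          by (metis abs_ge_zero power2_abs power_mono)
        have "norm k * norm u \<le> norm u"
          using k(2) by (simp add: mult_left_le_one_le)
        then have "exp \<bar>k \<bullet> u\<bar> \<le> exp (norm u)"
          using abs_le by simp
        then have "exp \<bar>k \<bullet> u\<bar> * (k \<bullet> u)\<^sup>2 \<le> exp (norm u) * (norm k * exp (norm u))\<^sup>2"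
          using sq by (intro mult_mono) auto
        then show "\<bar>exp (k \<bullet> u) - 1 - k \<bullet> u\<bar> \<le> exp (norm u) * (norm k * exp (norm u))\<^sup>2"
          using abs_exp_minus_linear_le[of "k \<bullet> u"] by linarith
      qed auto
      also have "\<dots> = (norm k)\<^sup>2 * (exp ((norm h + 3) * norm u) * norm (g u))"
      proof -
        have "(norm h + 3) * norm u = norm h * norm u + norm u + norm u + norm u"
          by (simp add: algebra_simps)
        then show ?thesis
          by (simp only: exp_add) (simp add: power2_eq_square)
      qed
      finally show ?thesis .
    qed
    have "norm ((\<integral>u. exp (y \<bullet> u) *\<^sub>R g u \<partial>lborel) - (\<integral>u. exp (h \<bullet> u) *\<^sub>R g u \<partial>lborel)
        - (\<integral>u. exp (h \<bullet> u) *\<^sub>R (k \<bullet> u) *\<^sub>R g u \<partial>lborel))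
      = norm (\<integral>u. exp (y \<bullet> u) *\<^sub>R g u - exp (h \<bullet> u) *\<^sub>R g u - exp (h \<bullet> u) *\<^sub>R (k \<bullet> u) *\<^sub>R g u \<partial>lborel)"
      using int0 int1 by simp
    also have "\<dots> \<le> (\<integral>u. (norm k)\<^sup>2 * (exp ((norm h + 3) * norm u) * norm (g u)) \<partial>lborel)"
    proof (rule Bochner_Integration.integral_norm_bound_integral)
      show "integrable lborel (\<lambda>u. (norm k)\<^sup>2 * (exp ((norm h + 3) * norm u) * norm (g u)))"
        using g by (simp add: exp_integrable_def)
    qed (use int0 int1 bound in auto)
    also have "\<dots> = C * norm k * norm k"
      by (simp add: C_def power2_eq_square)
    finally show ?thesis
      using k(1) by (simp add: k_def divide_le_eq)
  qed
  have "linear (\<lambda>k. \<integral>u. exp (h \<bullet> u) *\<^sub>R (k \<bullet> u) *\<^sub>R g u \<partial>lborel)"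
  proof
    show "(\<integral>u. exp (h \<bullet> u) *\<^sub>R ((k + k') \<bullet> u) *\<^sub>R g u \<partial>lborel)
      = (\<integral>u. exp (h \<bullet> u) *\<^sub>R (k \<bullet> u) *\<^sub>R g u \<partial>lborel) + (\<integral>u. exp (h \<bullet> u) *\<^sub>R (k' \<bullet> u) *\<^sub>R g u \<partial>lborel)" for k k'
      using int1 by (simp add: inner_add_left scaleR_add_left scaleR_add_right)
    show "(\<integral>u. exp (h \<bullet> u) *\<^sub>R ((r *\<^sub>R k) \<bullet> u) *\<^sub>R g u \<partial>lborel)
      = r *\<^sub>R (\<integral>u. exp (h \<bullet> u) *\<^sub>R (k \<bullet> u) *\<^sub>R g u \<partial>lborel)" for r k
      by (subst integral_scaleR_right[symmetric]) (simp add: mult_ac)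
  qed
  then have "bounded_linear (\<lambda>k. \<integral>u. exp (h \<bullet> u) *\<^sub>R (k \<bullet> u) *\<^sub>R g u \<partial>lborel)"
    by (simp add: linear_conv_bounded_linear)
  then show ?thesis
  proof (rule has_derivativeI_sandwich[where e = 1 and H = "\<lambda>y. C * norm (y - h)", rotated])
    have "((\<lambda>y. C * norm (y - h)) \<longlongrightarrow> C * norm (h - h)) (at h)"
      by (intro tendsto_intros)
    then show "((\<lambda>y. C * norm (y - h)) \<longlongrightarrow> 0) (at h)"
      by simp
  qed (use remainder in auto)
qed

section \<open>Gaussian convolutions are twice differentiable\<close>

text \<open>
  Completing the square gives \<open>a \<parallel>w\<parallel> \<le> \<parallel>w\<parallel>\<^sup>2 / (4 \<rho>\<^sup>2) + a\<^sup>2 \<rho>\<^sup>2\<close>, so that the exponential weight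
  only costs a constant and a doubling of the variance.
\<close>
lemma exp_integrable_gaussian_density:
  assumes "0 < \<rho>"
  shows "exp_integrable (gaussian_density \<rho> :: real ^ 'd \<Rightarrow> real)"
  unfolding exp_integrable_def
proof (intro conjI allI)
  fix a
  define \<sigma> where "\<sigma> = sqrt 2 * \<rho>"
  have \<sigma>: "0 < \<sigma>" "\<sigma>\<^sup>2 = 2 * \<rho>\<^sup>2"
    using assms by (simp_all add: \<sigma>_def power_mult_distrib)
  define Z where "Z = (\<lambda>s. (1 / sqrt (2 * pi * s\<^sup>2)) ^ CARD('d))"
  define C where "C = exp (a\<^sup>2 * \<rho>\<^sup>2) * Z \<rho> / Z \<sigma>"
  have dens: "gaussian_density s w = Z s * exp (- (norm w)\<^sup>2 / (2 * s\<^sup>2))"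
    for s and w :: "real ^ 'd"
    by (simp add: gaussian_density_eq_exp Z_def)
  have Z: "0 < Z s" if "0 < s" for s
    using that by (simp add: Z_def)
  have "integrable lborel (gaussian_density \<sigma> :: real ^ 'd \<Rightarrow> real)"
    using has_bochner_integral_gaussian_density[OF \<sigma>(1)]
    by (auto simp: has_bochner_integral_iff)
  then have "integrable lborel (\<lambda>w :: real ^ 'd. C * gaussian_density \<sigma> w)"
    by simp
  then show "integrable lborel (\<lambda>w :: real ^ 'd. exp (a * norm w) * norm (gaussian_density \<rho> w))"
  proof (rule Bochner_Integration.integrable_bound)
    show "AE w :: real ^ 'd in lborel. norm (exp (a * norm w) * norm (gaussian_density \<rho> w))
        \<le> norm (C * gaussian_density \<sigma> w)"
    proof (rule AE_I2)
      fix w :: "real ^ 'd"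
      have "a * norm w + - (norm w)\<^sup>2 / (2 * \<rho>\<^sup>2)
          = a\<^sup>2 * \<rho>\<^sup>2 + - (norm w)\<^sup>2 / (4 * \<rho>\<^sup>2) - (norm w / (2 * \<rho>) - a * \<rho>)\<^sup>2"
        using assms by (simp add: power2_eq_square field_simps)
      also have "\<dots> \<le> a\<^sup>2 * \<rho>\<^sup>2 + - (norm w)\<^sup>2 / (4 * \<rho>\<^sup>2)"
        by simp
      finally have "exp (a * norm w) * exp (- (norm w)\<^sup>2 / (2 * \<rho>\<^sup>2))
          \<le> exp (a\<^sup>2 * \<rho>\<^sup>2) * exp (- (norm w)\<^sup>2 / (4 * \<rho>\<^sup>2))"
        by (simp add: exp_add[symmetric])
      from mult_left_mono[OF this, of "Z \<rho>"]
      have "exp (a * norm w) * gaussian_density \<rho> w \<le> C * gaussian_density \<sigma> w"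
        using Z[OF assms] Z[OF \<sigma>(1)]
        by (simp add: dens C_def \<sigma>(2) mult_ac)
      then show "norm (exp (a * norm w) * norm (gaussian_density \<rho> w))
          \<le> norm (C * gaussian_density \<sigma> w)"
        by simp
    qed
  qed measurable
qed measurable

lemma lipschitz_measurable:
  assumes "L-lipschitz_on UNIV F"
  shows "F \<in> borel_measurable borel"
  using lipschitz_on_continuous_on[OF assms] by (rule borel_measurable_continuous_onI)

lemma exp_integrable_lipschitz_gaussian:
  fixes F :: "real ^ 'd \<Rightarrow> real"
  assumes F: "L-lipschitz_on UNIV F" and "0 < \<rho>"
  shows "exp_integrable (\<lambda>u. gaussian_density \<rho> u * F u)"
proof (rule exp_integrable_dominated[OF exp_integrable_gaussian_density[OF \<open>0 < \<rho>\<close>],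
      where C = "\<bar>F 0\<bar> + L" and a = 1])
  show "(\<lambda>u. gaussian_density \<rho> u * F u) \<in> borel_measurable borel"
    using lipschitz_measurable[OF F] by measurable
  fix u :: "real ^ 'd"
  have L: "0 \<le> L"
    using F by (rule lipschitz_on_nonneg)
  have "\<bar>F u - F 0\<bar> \<le> L * norm u"
    using lipschitz_on_normD[OF F, of u 0] by simp
  moreover have "L * norm u \<le> L * exp (norm u)"
    by (intro mult_left_mono norm_le_exp_norm L)
  moreover have "\<bar>F 0\<bar> * 1 \<le> \<bar>F 0\<bar> * exp (norm u)"
    by (intro mult_left_mono) auto
  ultimately have "\<bar>F u\<bar> \<le> (\<bar>F 0\<bar> + L) * exp (norm u)"
    unfolding distrib_right by linarith
  from mult_left_mono[OF this, of "gaussian_density \<rho> u"]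
  show "norm (gaussian_density \<rho> u * F u)
      \<le> (\<bar>F 0\<bar> + L) * exp (1 * norm u) * norm (gaussian_density \<rho> u)"
    by (simp add: abs_mult mult_ac)
qed

lemma gaussian_convolution_eq_kernel:
  fixes F :: "real ^ 'd \<Rightarrow> real"
  assumes F: "F \<in> borel_measurable borel"
  shows "gaussian_convolution \<rho> F x = (\<integral>u. gaussian_density \<rho> (x - u) * F u \<partial>lborel)"
proof -
  note [measurable] = F
  have "gaussian_convolution \<rho> F x = (\<integral>\<xi>. gaussian_density \<rho> \<xi> * F (x - \<xi>) \<partial>lborel)"
    unfolding gaussian_convolution_def isotropic_gaussian_def gaussian_density_def[symmetric]
    by (subst integral_density) auto
  also have "\<dots> = (\<integral>u. gaussian_density \<rho> (x - u) * F (x - (x - u)) \<partial>lborel)"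
    by (rule lborel_integral_reflect[symmetric]) measurable
  finally show ?thesis
    by simp
qed

text \<open>The factorisation that turns a Gaussian convolution into a Laplace transform.\<close>
lemma gaussian_density_diff_eq:
  "gaussian_density \<rho> (x - u) =
     exp (- (norm x)\<^sup>2 / (2 * \<rho>\<^sup>2)) * (exp ((x /\<^sub>R \<rho>\<^sup>2) \<bullet> u) * gaussian_density \<rho> u)"
proof -
  have "(norm (x - u))\<^sup>2 = (norm x)\<^sup>2 - 2 * (x \<bullet> u) + (norm u)\<^sup>2"
    by (simp add: power2_norm_eq_inner inner_diff_left inner_diff_right inner_commute)
  moreover have "- (a - 2 * b + d) / (2 * r) = - a / (2 * r) + b / r + - d / (2 * r)" for a b d r :: real
    by (cases "r = 0") (simp_all add: field_simps)
  ultimately have "- (norm (x - u))\<^sup>2 / (2 * \<rho>\<^sup>2)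
      = - (norm x)\<^sup>2 / (2 * \<rho>\<^sup>2) + (x \<bullet> u) / \<rho>\<^sup>2 + - (norm u)\<^sup>2 / (2 * \<rho>\<^sup>2)"
    by (simp only:)
  then have "exp (- (norm (x - u))\<^sup>2 / (2 * \<rho>\<^sup>2)) = exp (- (norm x)\<^sup>2 / (2 * \<rho>\<^sup>2))
      * exp ((x \<bullet> u) / \<rho>\<^sup>2) * exp (- (norm u)\<^sup>2 / (2 * \<rho>\<^sup>2))"
    by (simp only: exp_add)
  then show ?thesis
    by (simp only: gaussian_density_eq_exp inner_scaleR_left divide_inverse mult_ac)
qed

lemma integrable_gaussian_density_mult:
  fixes F :: "real ^ 'd \<Rightarrow> real"
  assumes "L-lipschitz_on UNIV F" and "0 < \<rho>"
  shows "integrable lborel (\<lambda>u. gaussian_density \<rho> (x - u) * F u)"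
  using exp_integrable_imp_integrable[OF exp_integrable_lipschitz_gaussian[OF assms], of "x /\<^sub>R \<rho>\<^sup>2"]
  by (simp add: gaussian_density_diff_eq mult.assoc)

lemma gaussian_convolution_eq_laplace:
  fixes F :: "real ^ 'd \<Rightarrow> real"
  assumes "F \<in> borel_measurable borel"
  shows "gaussian_convolution \<rho> F x = exp (- (norm x)\<^sup>2 / (2 * \<rho>\<^sup>2)) *
    (\<integral>u. exp ((x /\<^sub>R \<rho>\<^sup>2) \<bullet> u) *\<^sub>R (gaussian_density \<rho> u * F u) \<partial>lborel)"
  by (simp add: gaussian_convolution_eq_kernel[OF assms] gaussian_density_diff_eq mult.assoc)

text \<open>
  With \<open>c = 1 / \<rho>\<^sup>2\<close> the convolution is \<open>E z * M (c z)\<close>, where \<open>E z = exp (- c \<parallel>z\<parallel>\<^sup>2 / 2)\<close> and \<open>M\<close> is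
  the Laplace transform of the weighted function \<open>g = \<phi> F\<close>. Its gradient involves the transform
  \<open>A\<close> of \<open>g u *\<^sub>R u\<close>, the gradient of \<open>M\<close>, and the derivative of the gradient involves the
  derivative \<open>B\<close> of \<open>A\<close>. Symmetry of the second derivative is read off from the explicit formula,
  as \<open>v \<bullet> B h w\<close> is the integral of \<open>exp (h \<bullet> u) (v \<bullet> u) (w \<bullet> u) g u\<close>.
\<close>
lemma gaussian_convolution_twice_differentiable:
  fixes F :: "real ^ 'd \<Rightarrow> real"
  assumes F: "L-lipschitz_on UNIV F" and "0 < \<rho>"
  obtains G H where "\<And>z. GDERIV (gaussian_convolution \<rho> F) z :> G z"
    and "\<And>z. (G has_derivative H z) (at z)"
    and "\<And>z v w. v \<bullet> H z w = w \<bullet> H z v"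
proof -
  define c where "c = inverse (\<rho>\<^sup>2)"
  define g where "g = (\<lambda>u. gaussian_density \<rho> u * F u)"
  define M where "M = (\<lambda>h. \<integral>u. exp (h \<bullet> u) *\<^sub>R g u \<partial>lborel)"
  define A where "A = (\<lambda>h. \<integral>u. exp (h \<bullet> u) *\<^sub>R (g u *\<^sub>R u) \<partial>lborel)"
  define B where "B = (\<lambda>h k. \<integral>u. exp (h \<bullet> u) *\<^sub>R (k \<bullet> u) *\<^sub>R (g u *\<^sub>R u) \<partial>lborel)"
  define E where "E = (\<lambda>z :: real ^ 'd. exp (- (c / 2) * (z \<bullet> z)))"
  define G where "G = (\<lambda>z. E z *\<^sub>R (c *\<^sub>R (A (c *\<^sub>R z) - M (c *\<^sub>R z) *\<^sub>R z)))"
  define H where "H = (\<lambda>z k. E z *\<^sub>R (c *\<^sub>R (B (c *\<^sub>R z) (c *\<^sub>R k)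
      - (M (c *\<^sub>R z) *\<^sub>R k + ((c *\<^sub>R k) \<bullet> A (c *\<^sub>R z)) *\<^sub>R z)))
      + (- (c * (z \<bullet> k)) * E z) *\<^sub>R (c *\<^sub>R (A (c *\<^sub>R z) - M (c *\<^sub>R z) *\<^sub>R z)))"
  have g: "exp_integrable g"
    unfolding g_def by (rule exp_integrable_lipschitz_gaussian[OF assms])
  note gA = exp_integrable_scaleR_id[OF g]
  have "(\<integral>u. exp (h \<bullet> u) *\<^sub>R (k \<bullet> u) *\<^sub>R g u \<partial>lborel) = k \<bullet> A h" for h k
  proof -
    have "(\<integral>u. exp (h \<bullet> u) *\<^sub>R (k \<bullet> u) *\<^sub>R g u \<partial>lborel)
        = (\<integral>u. k \<bullet> (exp (h \<bullet> u) *\<^sub>R (g u *\<^sub>R u)) \<partial>lborel)"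
      by (simp add: mult_ac)
    also have "\<dots> = k \<bullet> A h"
      unfolding A_def by (rule integral_inner_right) (rule exp_integrable_imp_integrable[OF gA])
    finally show ?thesis .
  qed
  then have M': "(M has_derivative (\<lambda>k. k \<bullet> A h)) (at h)" for h
    using laplace_transform_has_derivative[OF g, of h] by (simp add: M_def)
  have A': "(A has_derivative B h) (at h)" for h
    using laplace_transform_has_derivative[OF gA, of h] by (simp add: A_def B_def[abs_def])
  have B_sym: "v \<bullet> B h w = w \<bullet> B h v" for h v w
  proof -
    have "v \<bullet> B h w = (\<integral>u. v \<bullet> (exp (h \<bullet> u) *\<^sub>R (w \<bullet> u) *\<^sub>R (g u *\<^sub>R u)) \<partial>lborel)" for v w
      unfolding B_def
      by (rule integral_inner_right[symmetric])
        (intro exp_integrable_imp_integrable exp_integrable_inner_scaleR gA)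
    then show ?thesis
      by (simp add: mult_ac)
  qed
  have B_scale: "v \<bullet> B h (c *\<^sub>R w) = c * (v \<bullet> B h w)" for h v w
    using linear_scale[OF has_derivative_linear[OF A']] by (simp)
  have scale': "((\<lambda>z. c *\<^sub>R z) has_derivative (\<lambda>k. c *\<^sub>R k)) (at z)" for z :: "real ^ 'd"
    by (auto intro!: derivative_eq_intros)
  have Mc: "((\<lambda>z. M (c *\<^sub>R z)) has_derivative (\<lambda>k. (c *\<^sub>R k) \<bullet> A (c *\<^sub>R z))) (at z)" for z
    using has_derivative_compose[OF scale' M'] .
  have Ac: "((\<lambda>z. A (c *\<^sub>R z)) has_derivative (\<lambda>k. B (c *\<^sub>R z) (c *\<^sub>R k))) (at z)" for z
    using has_derivative_compose[OF scale' A'] .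
  have E': "(E has_derivative (\<lambda>k. - (c * (z \<bullet> k)) * E z)) (at z)" for z
    unfolding E_def
    by (auto intro!: derivative_eq_intros simp: inner_commute algebra_simps)
  have E_eq: "E z = exp (- (norm z)\<^sup>2 / (2 * \<rho>\<^sup>2))" for z
    using \<open>0 < \<rho>\<close> by (simp add: E_def c_def power2_norm_eq_inner field_simps)
  have conv: "gaussian_convolution \<rho> F = (\<lambda>z. E z * M (c *\<^sub>R z))"
    unfolding E_eq M_def g_def c_def
    by (rule ext) (rule gaussian_convolution_eq_laplace[OF lipschitz_measurable[OF F]])
  show thesis
  proof
    show "GDERIV (gaussian_convolution \<rho> F) z :> G z" for z
      unfolding gderiv_def conv
      by (rule has_derivative_eq_rhs[OF has_derivative_mult[OF E' Mc]])
        (simp add: G_def fun_eq_iff inner_diff_right inner_diff_left inner_commute algebra_simps)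
    show "(G has_derivative H z) (at z)" for z
      unfolding G_def H_def
      by (intro has_derivative_scaleR[OF E'] has_derivative_scaleR_right has_derivative_diff Ac
          has_derivative_scaleR[OF Mc] has_derivative_ident)
    show "v \<bullet> H z w = w \<bullet> H z v" for z v w
      by (simp add: H_def B_scale B_sym[of v _ w] inner_diff_right inner_add_right
          inner_commute[of v z] inner_commute[of w z] inner_commute[of w v] algebra_simps)
  qed
qed

section \<open>Hessians as limits of second difference quotients\<close>

definition second_difference :: "('a::real_vector \<Rightarrow> real) \<Rightarrow> 'a \<Rightarrow> 'a \<Rightarrow> real" where
  "second_difference f k u = f (u + k) + f (u - k) - 2 * f u"

text \<open>
  By l'Hospital's rule in \<open>h\<close>, it suffices to take the limit of
  \<open>v \<bullet> (G (x + h v) - G (x - h v)) / (2 h)\<close>, a difference quotient of the gradient \<open>G\<close>.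
\<close>
lemma second_difference_quotient_tendsto:
  fixes g :: "'a::real_inner \<Rightarrow> real"
  assumes g: "\<And>z. GDERIV g z :> G z" and G: "(G has_derivative H) (at x)"
  shows "((\<lambda>h. second_difference g (h *\<^sub>R v) x / h\<^sup>2) \<longlongrightarrow> v \<bullet> H v) (at_right 0)"
proof -
  define f where "f = (\<lambda>h. g (x + h *\<^sub>R v) + g (x - h *\<^sub>R v) - 2 * g x)"
  define f' where "f' = (\<lambda>h. v \<bullet> (G (x + h *\<^sub>R v) - G (x - h *\<^sub>R v)))"
  have line: "((\<lambda>h. x + h *\<^sub>R w) has_derivative (\<lambda>k. k *\<^sub>R w)) (at h)" for w h
    by (auto intro!: derivative_eq_intros)
  have g_line: "((\<lambda>h. g (x + h *\<^sub>R w)) has_real_derivative w \<bullet> G (x + h *\<^sub>R w)) (at h)" for w h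
    unfolding has_field_derivative_def
    by (rule has_derivative_eq_rhs[OF has_derivative_compose[OF line g[unfolded gderiv_def]]])
      (auto simp: mult.commute)
  have G_line: "((\<lambda>h. v \<bullet> G (x + h *\<^sub>R w)) has_real_derivative v \<bullet> H w) (at 0)" for w
  proof -
    have "((\<lambda>h. G (x + h *\<^sub>R w)) has_derivative (\<lambda>k. H (k *\<^sub>R w))) (at 0)"
      using G by (intro has_derivative_compose[OF line]) simp
    from has_derivative_inner_right[OF this, of v] show ?thesis
      unfolding has_field_derivative_def
      by (rule has_derivative_eq_rhs)
        (auto simp: linear_scale[OF has_derivative_linear[OF G]] mult.commute)
  qed
  have f: "(f has_real_derivative f' h) (at h)" for h
    using DERIV_diff[OF DERIV_add[OF g_line[of v h] g_line[of "- v" h]] DERIV_const[of "2 * g x"]]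
    by (simp add: f_def f'_def inner_diff_right)
  have "((\<lambda>h. v \<bullet> G (x + h *\<^sub>R v) - v \<bullet> G (x + h *\<^sub>R (- v))) has_real_derivative
      v \<bullet> H v - v \<bullet> H (- v)) (at 0)"
    by (intro DERIV_diff G_line)
  then have "(f' has_real_derivative 2 * (v \<bullet> H v)) (at 0)"
    by (simp add: f'_def inner_diff_right linear_neg[OF has_derivative_linear[OF G]])
  then have "((\<lambda>h. f' h / h) \<longlongrightarrow> 2 * (v \<bullet> H v)) (at 0)"
    by (simp add: has_field_derivative_iff f'_def)
  then have "((\<lambda>h. f' h / h) \<longlongrightarrow> 2 * (v \<bullet> H v)) (at_right 0)"
    by (rule tendsto_within_subset) simp
  from tendsto_mult_left[OF this, of "1 / 2"]
  have quotient: "((\<lambda>h. f' h / (2 * h)) \<longlongrightarrow> v \<bullet> H v) (at_right 0)"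
    by simp
  have "(f \<longlongrightarrow> f 0) (at_right 0)"
    using DERIV_isCont[OF f[of 0]] unfolding isCont_def
    by (rule tendsto_within_subset) simp
  then have f0: "(f \<longlongrightarrow> 0) (at_right 0)"
    by (simp add: f_def)
  have "((\<lambda>h. f h / h\<^sup>2) \<longlongrightarrow> v \<bullet> H v) (at_right 0)"
  proof (rule lhopital_right_0[OF f0 _ _ _ _ _ quotient])
    show "((\<lambda>h :: real. h\<^sup>2) \<longlongrightarrow> 0) (at_right 0)"
      by (auto intro!: tendsto_eq_intros)
    show "\<forall>\<^sub>F h :: real in at_right 0. ((\<lambda>h. h\<^sup>2) has_real_derivative 2 * h) (at h)"
      by (auto intro!: always_eventually derivative_eq_intros)
  qed (use f in \<open>auto simp: eventually_at_right_less eventually_at_filter\<close>)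
  then show ?thesis
    by (simp add: f_def second_difference_def)
qed

lemma gradient_eqI:
  assumes "GDERIV g x :> D"
  shows "gradient g x = D"
  unfolding gradient_def
proof (rule the_equality)
  fix D' assume "GDERIV g x :> D'"
  then have "(\<lambda>h. h \<bullet> D') = (\<lambda>h. h \<bullet> D)"
    using assms unfolding gderiv_def by (rule has_derivative_unique)
  then show "D' = D"
    by (metis vector_eq_ldot)
qed fact

lemma
  fixes f :: "real ^ 'd \<Rightarrow> real"
  assumes "L-lipschitz_on UNIV f" and "0 < \<rho>"
  shows transpose_hessian_gaussian_convolution:
      "transpose (hessian (gaussian_convolution \<rho> f) x) = hessian (gaussian_convolution \<rho> f) x"
    and second_difference_gaussian_convolution_tendsto:
      "((\<lambda>h. second_difference (gaussian_convolution \<rho> f) (h *\<^sub>R v) x / h\<^sup>2)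
        \<longlongrightarrow> v \<bullet> (hessian (gaussian_convolution \<rho> f) x *v v)) (at_right 0)"
proof -
  obtain G H where G: "\<And>z. GDERIV (gaussian_convolution \<rho> f) z :> G z"
    and H: "\<And>z. (G has_derivative H z) (at z)" and sym: "\<And>z v w. v \<bullet> H z w = w \<bullet> H z v"
    using gaussian_convolution_twice_differentiable[OF assms] by metis
  have "gradient (gaussian_convolution \<rho> f) = G"
    using gradient_eqI[OF G] by auto
  then have hess: "hessian (gaussian_convolution \<rho> f) x = matrix (H x)"
    by (simp add: hessian_def jacobian_def frechet_derivative_at[OF H, symmetric])
  have "H x (axis i 1) $ j = H x (axis j 1) $ i" for i j
    using sym[of "axis j 1" x "axis i 1"] by (simp add: inner_axis')
  then show "transpose (hessian (gaussian_convolution \<rho> f) x) = hessian (gaussian_convolution \<rho> f) x"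
    by (simp add: hess matrix_def transpose_def)
  have "hessian (gaussian_convolution \<rho> f) x *v v = H x v"
    by (simp add: hess matrix_works linear_matrix_vector_mul_eq has_derivative_linear[OF H])
  then show "((\<lambda>h. second_difference (gaussian_convolution \<rho> f) (h *\<^sub>R v) x / h\<^sup>2)
        \<longlongrightarrow> v \<bullet> (hessian (gaussian_convolution \<rho> f) x *v v)) (at_right 0)"
    using second_difference_quotient_tendsto[OF G H, of v x] by simp
qed

section \<open>Comparing translates of the Gaussian\<close>

text \<open>
  A translation by \<open>r e\<close> changes the density by the factor \<open>exp ((2 r (e \<bullet> w) + r\<^sup>2 \<parallel>e\<parallel>\<^sup>2) / (2 \<rho>\<^sup>2))\<close>.
  In the half space \<open>e \<bullet> w \<le> \<rho> t\<close> this controls the translation by \<open>r = D\<close>; outside of it the choice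
  \<open>r = - \<rho> t\<close> gains the factor \<open>exp (- t\<^sup>2 / 2)\<close>. The bound \<open>\<parallel>e\<parallel> \<le> 1\<close> in place of equality admits
  \<open>e = 0\<close>, the direction between two equal points.
\<close>
lemma gaussian_density_le_translates:
  fixes w e :: "real ^ 'd"
  assumes "0 < \<rho>" "norm e \<le> 1" "0 \<le> D" "0 \<le> t"
  shows "gaussian_density \<rho> w \<le>
    exp (D\<^sup>2 / (2 * \<rho>\<^sup>2) + D * t / \<rho>) * gaussian_density \<rho> (w + D *\<^sub>R e)
    + exp (- t\<^sup>2 / 2) * gaussian_density \<rho> (w - (\<rho> * t) *\<^sub>R e)"
proof -
  have ratio: "gaussian_density \<rho> w =
      exp ((2 * r * (e \<bullet> w) + r\<^sup>2 * (norm e)\<^sup>2) / (2 * \<rho>\<^sup>2)) * gaussian_density \<rho> (w + r *\<^sub>R e)" for r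
  proof -
    have "(norm (w + r *\<^sub>R e))\<^sup>2 = (norm w)\<^sup>2 + (2 * r * (e \<bullet> w) + r\<^sup>2 * (norm e)\<^sup>2)"
      by (simp only: power2_norm_eq_inner)
        (simp add: inner_add_left inner_add_right inner_commute power2_eq_square algebra_simps)
    then have "- (norm w)\<^sup>2 / (2 * \<rho>\<^sup>2) = (2 * r * (e \<bullet> w) + r\<^sup>2 * (norm e)\<^sup>2) / (2 * \<rho>\<^sup>2)
        + - (norm (w + r *\<^sub>R e))\<^sup>2 / (2 * \<rho>\<^sup>2)"
      by (simp add: add_divide_distrib[symmetric] del: times_divide_eq_left)
    then show ?thesis
      by (simp only: gaussian_density_eq_exp exp_add) simp
  qed
  have e2: "r\<^sup>2 * (norm e)\<^sup>2 \<le> r\<^sup>2" for r :: real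
    using assms(2) by (simp add: mult_left_le power_le_one)
  show ?thesis
  proof (cases "e \<bullet> w \<le> \<rho> * t")
    case True
    have "(2 * D * (e \<bullet> w) + D\<^sup>2 * (norm e)\<^sup>2) / (2 * \<rho>\<^sup>2) \<le> (2 * D * (\<rho> * t) + D\<^sup>2) / (2 * \<rho>\<^sup>2)"
      using True e2[of D] assms by (intro divide_right_mono add_mono mult_left_mono) auto
    also have "\<dots> = D\<^sup>2 / (2 * \<rho>\<^sup>2) + D * t / \<rho>"
      using assms(1) by (simp add: field_simps power2_eq_square)
    finally have "gaussian_density \<rho> w
        \<le> exp (D\<^sup>2 / (2 * \<rho>\<^sup>2) + D * t / \<rho>) * gaussian_density \<rho> (w + D *\<^sub>R e)"
      by (subst ratio[of D]) (intro mult_right_mono, auto)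
    then show ?thesis
      by (simp add: add_increasing2)
  next
    case False
    define r where "r = - (\<rho> * t)"
    have "r * (e \<bullet> w) \<le> r * (\<rho> * t)"
      using False assms by (intro mult_left_mono_neg) (auto simp: r_def)
    then have "(2 * r * (e \<bullet> w) + r\<^sup>2 * (norm e)\<^sup>2) / (2 * \<rho>\<^sup>2) \<le> (2 * r * (\<rho> * t) + r\<^sup>2) / (2 * \<rho>\<^sup>2)"
      using e2[of r] by (intro divide_right_mono add_mono) auto
    also have "\<dots> = - t\<^sup>2 / 2"
      using assms(1) by (simp add: r_def field_simps power2_eq_square)
    finally have "gaussian_density \<rho> w \<le> exp (- t\<^sup>2 / 2) * gaussian_density \<rho> (w + r *\<^sub>R e)"
      by (subst ratio[of r]) (intro mult_right_mono, auto)
    then show ?thesis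
      by (simp add: r_def add_increasing)
  qed
qed

lemma gaussian_convolution_le_translates:
  fixes F :: "real ^ 'd \<Rightarrow> real"
  assumes F: "L-lipschitz_on UNIV F" and nonneg: "\<And>u. 0 \<le> F u" and "0 < \<rho>" and "0 \<le> t"
  shows "gaussian_convolution \<rho> F x \<le>
    exp ((norm (x - y))\<^sup>2 / (2 * \<rho>\<^sup>2) + norm (x - y) * t / \<rho>) * gaussian_convolution \<rho> F y
    + exp (- t\<^sup>2 / 2) * gaussian_convolution \<rho> F (x - (\<rho> * t) *\<^sub>R sgn (y - x))"
proof -
  define e where "e = sgn (y - x)"
  define D where "D = norm (x - y)"
  define C where "C = exp (D\<^sup>2 / (2 * \<rho>\<^sup>2) + D * t / \<rho>)"
  define \<delta> where "\<delta> = exp (- t\<^sup>2 / 2)"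
  define x' where "x' = x - (\<rho> * t) *\<^sub>R e"
  have e: "norm e \<le> 1" "x + D *\<^sub>R e = y"
    by (simp add: e_def norm_sgn)
      (cases "x = y"; simp add: e_def D_def sgn_div_norm norm_minus_commute)
  note int = integrable_gaussian_density_mult[OF F \<open>0 < \<rho>\<close>]
  have "(\<integral>u. gaussian_density \<rho> (x - u) * F u \<partial>lborel)
      \<le> (\<integral>u. C * (gaussian_density \<rho> (y - u) * F u) + \<delta> * (gaussian_density \<rho> (x' - u) * F u) \<partial>lborel)"
  proof (rule integral_mono)
    fix u
    have shift: "x - u + D *\<^sub>R e = y - u" "x - u - (\<rho> * t) *\<^sub>R e = x' - u"
      by (auto simp: x'_def simp flip: e(2))
    have "gaussian_density \<rho> (x - u)
        \<le> C * gaussian_density \<rho> (y - u) + \<delta> * gaussian_density \<rho> (x' - u)"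
      using gaussian_density_le_translates[OF \<open>0 < \<rho>\<close> e(1) _ \<open>0 \<le> t\<close>, of D "x - u"]
      unfolding shift C_def \<delta>_def by (simp add: D_def)
    from mult_right_mono[OF this nonneg[of u]]
    show "gaussian_density \<rho> (x - u) * F u
        \<le> C * (gaussian_density \<rho> (y - u) * F u) + \<delta> * (gaussian_density \<rho> (x' - u) * F u)"
      by (simp add: algebra_simps)
  qed (use int in auto)
  also have "\<dots> = C * (\<integral>u. gaussian_density \<rho> (y - u) * F u \<partial>lborel)
      + \<delta> * (\<integral>u. gaussian_density \<rho> (x' - u) * F u \<partial>lborel)"
    using int by simp
  finally show ?thesis
    by (simp add: gaussian_convolution_eq_kernel[OF lipschitz_measurable[OF F]]
        C_def \<delta>_def D_def x'_def e_def)
qed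

lemma gaussian_convolution_one:
  assumes "0 < \<rho>"
  shows "gaussian_convolution \<rho> (\<lambda>_. 1) (x :: real ^ 'd) = 1"
  using assms has_bochner_integral_gaussian_density[OF assms, where 'd = 'd]
  by (simp add: gaussian_convolution_eq_kernel lborel_integral_reflect has_bochner_integral_iff)

text \<open>
  This is the inequality between arithmetic and geometric means for \<open>l p\<close> and \<open>(p - q)\<^sup>2 / (l p)\<close>,
  where \<open>r\<close> stands for \<open>q\<^sup>2 / p\<close>. Integrated over densities \<open>p\<close> and \<open>q\<close> and optimised over \<open>l\<close>, it bounds
  the \<open>L\<^sup>1\<close> distance by the square root of the \<open>\<chi>\<^sup>2\<close> divergence.
\<close>
lemma abs_diff_le_chi_square:
  fixes p q r l :: real
  assumes "0 < p" "0 < l" "q\<^sup>2 = p * r"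
  shows "\<bar>p - q\<bar> \<le> (l * p + (p - 2 * q + r) / l) / 2"
proof -
  have "2 * \<bar>p - q\<bar> * (l * p) \<le> (l * p)\<^sup>2 + (p - q)\<^sup>2"
    using sum_squares_bound[of "\<bar>p - q\<bar>" "l * p"] by (simp add: mult.assoc)
  also have "(p - q)\<^sup>2 = p * (p - 2 * q + r)"
    using assms(3) by (simp add: power2_eq_square algebra_simps)
  finally have "p * (2 * \<bar>p - q\<bar> * l) \<le> p * (l\<^sup>2 * p + (p - 2 * q + r))"
    by (simp add: power2_eq_square algebra_simps)
  then have "2 * \<bar>p - q\<bar> * l \<le> l\<^sup>2 * p + (p - 2 * q + r)"
    using assms(1) by simp
  then show ?thesis
    using assms(2) by (simp add: field_simps power2_eq_square)
qed

text \<open>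
  The \<open>\<chi>\<^sup>2\<close> divergence between Gaussians centred at \<open>a\<close> and \<open>b\<close> is explicit: with
  \<open>s = \<parallel>a - b\<parallel> / \<rho>\<close>, the quotient of the square of the second density by the first is
  \<open>exp (s\<^sup>2)\<close> times the density of the Gaussian centred at \<open>2 b - a\<close>, so the divergence is
  \<open>exp (s\<^sup>2) - 1\<close>. For \<open>s \<le> 1\<close> this is at most \<open>2 s\<^sup>2\<close>, which is where the factor \<open>sqrt 2\<close> of
  \<open>\<epsilon>_add\<close> comes from.
\<close>
lemma gaussian_convolution_bounded_diff_le:
  fixes F :: "real ^ 'd \<Rightarrow> real"
  assumes F: "L-lipschitz_on UNIV F" and bound: "\<And>u. \<bar>F u\<bar> \<le> K"
    and "0 < \<rho>" and near: "norm (a - b) \<le> \<rho>"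
  shows "gaussian_convolution \<rho> F a - gaussian_convolution \<rho> F b \<le> sqrt 2 * K * norm (a - b) / \<rho>"
proof (cases "a = b")
  case False
  define s where "s = norm (a - b) / \<rho>"
  \<comment> \<open>the minimiser of \<open>l + 2 s\<^sup>2 / l\<close>\<close>
  define l where "l = sqrt 2 * s"
  have s: "0 < s" "s \<le> 1"
    using False assms by (auto simp: s_def)
  have l: "0 < l" "l\<^sup>2 = 2 * s\<^sup>2"
    using s by (auto simp: l_def power_mult_distrib)
  have K: "0 \<le> K"
    using bound[of 0] by linarith
  let ?p = "\<lambda>u. gaussian_density \<rho> (a - u)" and ?q = "\<lambda>u. gaussian_density \<rho> (b - u)"
    and ?r = "\<lambda>u. exp (s\<^sup>2) * gaussian_density \<rho> (2 *\<^sub>R b - a - u)"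
  have pqr: "(?q u)\<^sup>2 = ?p u * ?r u" for u
  proof -
    have "(norm (a - u))\<^sup>2 + (norm (2 *\<^sub>R b - a - u))\<^sup>2 = 2 * (norm (b - u))\<^sup>2 + 2 * (norm (a - b))\<^sup>2"
      by (simp only: power2_norm_eq_inner)
        (simp add: inner_diff_left inner_diff_right inner_commute)
    then have "- (norm (b - u))\<^sup>2 + - (norm (b - u))\<^sup>2
        = - (norm (a - u))\<^sup>2 + (2 * (norm (a - b))\<^sup>2 + - (norm (2 *\<^sub>R b - a - u))\<^sup>2)"
      by linarith
    moreover have "s\<^sup>2 = 2 * (norm (a - b))\<^sup>2 / (2 * \<rho>\<^sup>2)"
      by (simp add: s_def power_divide)
    ultimately have "- (norm (b - u))\<^sup>2 / (2 * \<rho>\<^sup>2) + - (norm (b - u))\<^sup>2 / (2 * \<rho>\<^sup>2)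
        = - (norm (a - u))\<^sup>2 / (2 * \<rho>\<^sup>2) + (s\<^sup>2 + - (norm (2 *\<^sub>R b - a - u))\<^sup>2 / (2 * \<rho>\<^sup>2))"
      by (simp only: add_divide_distrib[symmetric])
    then have "exp (- (norm (b - u))\<^sup>2 / (2 * \<rho>\<^sup>2)) * exp (- (norm (b - u))\<^sup>2 / (2 * \<rho>\<^sup>2))
        = exp (- (norm (a - u))\<^sup>2 / (2 * \<rho>\<^sup>2))
          * (exp (s\<^sup>2) * exp (- (norm (2 *\<^sub>R b - a - u))\<^sup>2 / (2 * \<rho>\<^sup>2)))"
      by (simp only: exp_add[symmetric])
    then show ?thesis
      by (simp add: gaussian_density_eq_exp power2_eq_square mult_ac)
  qed
  have dens: "integrable lborel (\<lambda>u. gaussian_density \<rho> (x - u))"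
      "(\<integral>u. gaussian_density \<rho> (x - u) \<partial>lborel) = 1" for x :: "real ^ 'd"
    using integrable_gaussian_density_mult[OF lipschitz_on_constant \<open>0 < \<rho>\<close>, of x 1]
      gaussian_convolution_one[OF \<open>0 < \<rho>\<close>, of x]
    by (simp_all add: gaussian_convolution_eq_kernel)
  note int = integrable_gaussian_density_mult[OF F \<open>0 < \<rho>\<close>]
  have "gaussian_convolution \<rho> F a - gaussian_convolution \<rho> F b
      = (\<integral>u. ?p u * F u - ?q u * F u \<partial>lborel)"
    using int by (simp add: gaussian_convolution_eq_kernel[OF lipschitz_measurable[OF F]])
  also have "\<dots> \<le> (\<integral>u. K * ((l * ?p u + (?p u - 2 * ?q u + ?r u) / l) / 2) \<partial>lborel)"
  proof (rule integral_mono)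
    fix u
    have "?p u * F u - ?q u * F u \<le> \<bar>?p u - ?q u\<bar> * \<bar>F u\<bar>"
      by (metis abs_ge_self abs_mult left_diff_distrib)
    also have "\<dots> \<le> \<bar>?p u - ?q u\<bar> * K"
      by (intro mult_left_mono bound) simp
    also have "\<dots> \<le> (l * ?p u + (?p u - 2 * ?q u + ?r u) / l) / 2 * K"
      using gaussian_density_pos[OF \<open>0 < \<rho>\<close>] l(1) pqr K
      by (intro mult_right_mono abs_diff_le_chi_square) auto
    finally show "?p u * F u - ?q u * F u \<le> K * ((l * ?p u + (?p u - 2 * ?q u + ?r u) / l) / 2)"
      by (simp only: mult.commute)
  qed (use int dens(1) in auto)
  also have "\<dots> = K * ((l + (exp (s\<^sup>2) - 1) / l) / 2)"
    using dens by simp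
  also have "\<dots> \<le> K * ((l + 2 * s\<^sup>2 / l) / 2)"
  proof -
    have "exp (s\<^sup>2) \<le> 1 + s\<^sup>2 + (s\<^sup>2)\<^sup>2"
      using s by (intro exp_bound) (auto simp: power_le_one)
    moreover have "(s\<^sup>2)\<^sup>2 \<le> s\<^sup>2"
      using s power_decreasing[of 2 4 s] by (simp flip: power_mult)
    ultimately have "exp (s\<^sup>2) - 1 \<le> 2 * s\<^sup>2"
      by linarith
    then show ?thesis
      using K l(1) by (intro mult_left_mono divide_right_mono add_left_mono) auto
  qed
  also have "\<dots> = K * l"
    using l by (simp add: power2_eq_square[of l] flip: l(2))
  finally show ?thesis
    by (simp add: l_def s_def mult_ac)
qed auto

section \<open>Second differences of convolutions\<close>

lemma second_difference_nonneg:
  assumes "convex_on UNIV f"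
  shows "0 \<le> second_difference f k u"
proof -
  have "f ((1 / 2) *\<^sub>R (u + k) + (1 / 2) *\<^sub>R (u - k)) \<le> (1 / 2) * f (u + k) + (1 / 2) * f (u - k)"
    using convex_onD[OF assms, of "1 / 2" "u + k" "u - k"] by simp
  moreover have "(1 / 2) *\<^sub>R (u + k) + (1 / 2) *\<^sub>R (u - k) = u"
    by (simp add: scaleR_add_right scaleR_diff_right flip: scaleR_left_distrib)
  ultimately show ?thesis
    by (simp add: second_difference_def)
qed

lemma gaussian_convolution_translate:
  "gaussian_convolution \<rho> f (x + k) = gaussian_convolution \<rho> (\<lambda>u. f (u + k)) x"
  by (simp add: gaussian_convolution_def algebra_simps)

lemma lipschitz_translate:
  fixes f :: "'a::real_normed_vector \<Rightarrow> real"
  assumes "L-lipschitz_on UNIV f"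
  shows "L-lipschitz_on UNIV (\<lambda>u. f (u + k))"
  unfolding lipschitz_on_def
proof (intro conjI ballI)
  show "dist (f (u + k)) (f (v + k)) \<le> L * dist u v" for u v
    using lipschitz_onD[OF assms, of "u + k" "v + k"] by simp
qed (rule lipschitz_on_nonneg[OF assms])

lemma lipschitz_second_difference:
  fixes f :: "'a::real_normed_vector \<Rightarrow> real"
  assumes "L-lipschitz_on UNIV f"
  shows "(4 * L)-lipschitz_on UNIV (second_difference f k)"
proof -
  have "((L + L) + \<bar>2\<bar> * L)-lipschitz_on UNIV (\<lambda>u. f (u + k) + f (u + - k) - 2 * f u)"
    by (intro lipschitz_on_diff lipschitz_on_add lipschitz_on_cmult_real lipschitz_translate assms)
  then show ?thesis
    by (simp add: second_difference_def[abs_def])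
qed

lemma gaussian_convolution_diff:
  fixes f g :: "real ^ 'd \<Rightarrow> real"
  assumes f: "L-lipschitz_on UNIV f" and g: "M-lipschitz_on UNIV g" and "0 < \<rho>"
  shows "gaussian_convolution \<rho> (\<lambda>u. f u - g u) x = gaussian_convolution \<rho> f x - gaussian_convolution \<rho> g x"
  using integrable_gaussian_density_mult[OF f \<open>0 < \<rho>\<close>] integrable_gaussian_density_mult[OF g \<open>0 < \<rho>\<close>]
    lipschitz_measurable[OF f] lipschitz_measurable[OF g]
  by (simp add: gaussian_convolution_eq_kernel right_diff_distrib)

lemma second_difference_eq_diff:
  "second_difference f k u = (f (u + k) - f u) - (f u - f (u + - k))"
  by (simp add: second_difference_def)

lemma gaussian_convolution_second_difference:
  fixes f :: "real ^ 'd \<Rightarrow> real"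
  assumes f: "L-lipschitz_on UNIV f" and "0 < \<rho>"
  shows "gaussian_convolution \<rho> (second_difference f k) x = second_difference (gaussian_convolution \<rho> f) k x"
proof -
  note translate = lipschitz_translate[OF f]
  have "gaussian_convolution \<rho> (second_difference f k) x
      = gaussian_convolution \<rho> (\<lambda>u. f (u + k) - f u) x - gaussian_convolution \<rho> (\<lambda>u. f u - f (u + - k)) x"
    unfolding second_difference_eq_diff[abs_def]
    by (rule gaussian_convolution_diff[OF lipschitz_on_diff[OF translate f]
          lipschitz_on_diff[OF f translate] \<open>0 < \<rho>\<close>])
  also have "\<dots> = second_difference (gaussian_convolution \<rho> f) k x"
    unfolding second_difference_eq_diff gaussian_convolution_translate
    by (simp only: gaussian_convolution_diff[OF translate f \<open>0 < \<rho>\<close>]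
        gaussian_convolution_diff[OF f translate \<open>0 < \<rho>\<close>])
  finally show ?thesis .
qed

text \<open>
  A second difference of the convolution is a first difference of the convolution of
  \<open>F u = f (u + k) - f u\<close>. The Lipschitz condition bounds \<open>F\<close> by \<open>L \<parallel>k\<parallel>\<close>, and smoothing turns this
  bound into a gain of another factor \<open>\<parallel>k\<parallel> / \<rho>\<close>.
\<close>
lemma second_difference_gaussian_convolution_le:
  fixes f :: "real ^ 'd \<Rightarrow> real"
  assumes f: "L-lipschitz_on UNIV f" and "0 < \<rho>" and "norm k \<le> \<rho>"
  shows "second_difference (gaussian_convolution \<rho> f) k x \<le> sqrt 2 * L * (norm k)\<^sup>2 / \<rho>"
proof -
  define F where "F = (\<lambda>u. f (u + k) - f u)"
  note translate = lipschitz_translate[OF f]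
  have F: "(L + L)-lipschitz_on UNIV F"
    unfolding F_def by (rule lipschitz_on_diff[OF translate f])
  have conv_F: "gaussian_convolution \<rho> F z = gaussian_convolution \<rho> f (z + k) - gaussian_convolution \<rho> f z" for z
    unfolding F_def gaussian_convolution_translate
    by (rule gaussian_convolution_diff[OF translate f \<open>0 < \<rho>\<close>])
  have "second_difference (gaussian_convolution \<rho> f) k x
      = gaussian_convolution \<rho> F x - gaussian_convolution \<rho> F (x - k)"
    by (simp add: conv_F second_difference_def)
  also have "\<dots> \<le> sqrt 2 * (L * norm k) * norm (x - (x - k)) / \<rho>"
  proof (rule gaussian_convolution_bounded_diff_le[OF F _ \<open>0 < \<rho>\<close>])
    show "\<bar>F u\<bar> \<le> L * norm k" for u
      using lipschitz_on_normD[OF f, of "u + k" u] by (simp add: F_def)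
  qed (use assms in simp)
  also have "\<dots> = sqrt 2 * L * (norm k)\<^sup>2 / \<rho>"
    by (simp add: power2_eq_square)
  finally show ?thesis .
qed

section \<open>Comparing Hessians of the convolution\<close>

lemma hessian_gaussian_convolution_nonneg:
  fixes f :: "real ^ 'd \<Rightarrow> real"
  assumes "convex_on UNIV f" and f: "L-lipschitz_on UNIV f" and "0 < \<rho>"
  shows "0 \<le> v \<bullet> (hessian (gaussian_convolution \<rho> f) x *v v)"
proof (rule tendsto_lowerbound[OF second_difference_gaussian_convolution_tendsto[OF f \<open>0 < \<rho>\<close>]])
  have "0 \<le> second_difference (gaussian_convolution \<rho> f) k x" for k
    unfolding gaussian_convolution_second_difference[OF f \<open>0 < \<rho>\<close>, symmetric]
    unfolding gaussian_convolution_def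
    by (rule Bochner_Integration.integral_nonneg) (rule second_difference_nonneg[OF assms(1)])
  then show "\<forall>\<^sub>F h in at_right 0. 0 \<le> second_difference (gaussian_convolution \<rho> f) (h *\<^sub>R v) x / h\<^sup>2"
    by simp
qed simp

text \<open>
  The comparison of weights, applied to the nonnegative second differences of \<open>f\<close>; the term with
  factor \<open>\<delta>\<close> is of order \<open>\<parallel>k\<parallel>\<^sup>2\<close>, so it survives the division by \<open>h\<^sup>2\<close> as the additive error.
\<close>
lemma hessian_gaussian_convolution_le:
  fixes f :: "real ^ 'd \<Rightarrow> real"
  assumes convex: "convex_on UNIV f" and f: "L-lipschitz_on UNIV f" and "0 < \<rho>"
    and \<delta>: "0 < \<delta>" "\<delta> \<le> 1"
  shows "v \<bullet> (hessian (gaussian_convolution \<rho> f) x *v v) \<le>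
    exp ((norm (x - y))\<^sup>2 / (2 * \<rho>\<^sup>2) + norm (x - y) * sqrt (2 * ln (1 / \<delta>)) / \<rho>)
      * (v \<bullet> (hessian (gaussian_convolution \<rho> f) y *v v))
    + sqrt 2 * L * \<delta> / \<rho> * (v \<bullet> v)"
proof -
  \<comment> \<open>the threshold whose Gaussian tail factor is exactly \<open>\<delta>\<close>\<close>
  define t where "t = sqrt (2 * ln (1 / \<delta>))"
  have t: "0 \<le> t" "exp (- t\<^sup>2 / 2) = \<delta>"
    using \<delta> by (simp_all add: t_def ln_div)
  define C where "C = exp ((norm (x - y))\<^sup>2 / (2 * \<rho>\<^sup>2) + norm (x - y) * t / \<rho>)"
  let ?S = "second_difference (gaussian_convolution \<rho> f)"
  have step: "?S k x \<le> C * ?S k y + sqrt 2 * L * \<delta> / \<rho> * (norm k)\<^sup>2" if k: "norm k \<le> \<rho>" for k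
  proof -
    define z where "z = x - (\<rho> * t) *\<^sub>R sgn (y - x)"
    have "?S k x \<le> C * ?S k y + \<delta> * ?S k z"
      using gaussian_convolution_le_translates[OF lipschitz_second_difference[OF f]
          second_difference_nonneg[OF convex] \<open>0 < \<rho>\<close> t(1), of k x y]
      by (simp only: gaussian_convolution_second_difference[OF f \<open>0 < \<rho>\<close>] C_def z_def t(2))
    moreover have "\<delta> * ?S k z \<le> \<delta> * (sqrt 2 * L * (norm k)\<^sup>2 / \<rho>)"
      using second_difference_gaussian_convolution_le[OF f \<open>0 < \<rho>\<close> k] \<delta>
      by (intro mult_left_mono) auto
    ultimately show ?thesis
      by (simp add: mult_ac)
  qed
  have "((\<lambda>h. C * (?S (h *\<^sub>R v) y / h\<^sup>2) + sqrt 2 * L * \<delta> / \<rho> * (v \<bullet> v))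
      \<longlongrightarrow> C * (v \<bullet> (hessian (gaussian_convolution \<rho> f) y *v v)) + sqrt 2 * L * \<delta> / \<rho> * (v \<bullet> v)) (at_right 0)"
    by (intro tendsto_intros second_difference_gaussian_convolution_tendsto[OF f \<open>0 < \<rho>\<close>])
  moreover have "((\<lambda>h. ?S (h *\<^sub>R v) x / h\<^sup>2)
      \<longlongrightarrow> v \<bullet> (hessian (gaussian_convolution \<rho> f) x *v v)) (at_right 0)"
    by (rule second_difference_gaussian_convolution_tendsto[OF f \<open>0 < \<rho>\<close>])
  moreover have "\<forall>\<^sub>F h in at_right 0. ?S (h *\<^sub>R v) x / h\<^sup>2
      \<le> C * (?S (h *\<^sub>R v) y / h\<^sup>2) + sqrt 2 * L * \<delta> / \<rho> * (v \<bullet> v)"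
  proof -
    have "((\<lambda>h. norm (h *\<^sub>R v)) \<longlongrightarrow> norm (0 *\<^sub>R v)) (at_right 0)"
      by (intro tendsto_intros)
    then have "\<forall>\<^sub>F h in at_right 0. norm (h *\<^sub>R v) < \<rho>"
      by (rule order_tendstoD) (use \<open>0 < \<rho>\<close> in simp)
    moreover have "\<forall>\<^sub>F h :: real in at_right 0. 0 < h"
      by (rule eventually_at_right_less)
    ultimately show ?thesis
    proof eventually_elim
      case (elim h)
      have "?S (h *\<^sub>R v) x \<le> C * ?S (h *\<^sub>R v) y + sqrt 2 * L * \<delta> / \<rho> * (h\<^sup>2 * (v \<bullet> v))"
        using step[of "h *\<^sub>R v"] elim(1) by (simp add: power_mult_distrib power2_norm_eq_inner)
      then have "?S (h *\<^sub>R v) x / h\<^sup>2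
          \<le> (C * ?S (h *\<^sub>R v) y + sqrt 2 * L * \<delta> / \<rho> * (h\<^sup>2 * (v \<bullet> v))) / h\<^sup>2"
        by (rule divide_right_mono) simp
      also have "\<dots> = C * (?S (h *\<^sub>R v) y / h\<^sup>2) + sqrt 2 * L * \<delta> / \<rho> * (v \<bullet> v)"
        using elim(2) by (simp add: add_divide_distrib)
      finally show ?case .
    qed
  qed
  ultimately show ?thesis
    unfolding C_def t_def by (intro tendsto_le[OF trivial_limit_at_right_real])
qed

lemma loewner_leI:
  assumes "transpose A = A" "transpose B = B"
    and "\<And>v. v \<bullet> (A *v v) \<le> c * (v \<bullet> (B *v v)) + a * (v \<bullet> v)"
  shows "A \<preceq>\<^sub>L c *\<^sub>R B + a *\<^sub>R mat 1"
proof -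
  have "transpose (c *\<^sub>R B + a *\<^sub>R mat 1 - A) = c *\<^sub>R transpose B + a *\<^sub>R mat 1 - transpose A"
    by (auto simp: vec_eq_iff transpose_def mat_def)
  moreover have "v \<bullet> ((c *\<^sub>R B + a *\<^sub>R mat 1 - A) *v v)
      = c * (v \<bullet> (B *v v)) + a * (v \<bullet> v) - v \<bullet> (A *v v)" for v
    by (simp add: matrix_vector_mult_diff_rdistrib matrix_vector_mult_add_rdistrib
        inner_diff_right inner_add_right flip: scaleR_matrix_vector_assoc)
  ultimately show ?thesis
    using assms by (simp add: loewner_le_def positive_semidefinite_def)
qed

theorem lemma1:
  fixes f :: "real ^ 'd \<Rightarrow> real" and L \<rho> \<delta> :: real and x y :: "real ^ 'd"
  assumes "convex_on UNIV f"
    and "L-lipschitz_on UNIV f"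
    and "\<rho> > 0"
    and "0 < \<delta>" and "\<delta> < 1"
  shows "is_approximation
           (sqrt 2 * L * \<delta> / \<rho>)
           ((norm (x - y))\<^sup>2 / \<rho>\<^sup>2 + 2 * norm (x - y) * sqrt (ln (1 / \<delta>)) / \<rho>)
           (hessian (gaussian_convolution \<rho> f) x)
           (hessian (gaussian_convolution \<rho> f) y)"
proof -
  let ?H = "hessian (gaussian_convolution \<rho> f)"
  let ?\<epsilon> = "\<lambda>x y. (norm (x - y))\<^sup>2 / \<rho>\<^sup>2 + 2 * norm (x - y) * sqrt (ln (1 / \<delta>)) / \<rho>"
  note sym = transpose_hessian_gaussian_convolution[OF assms(2,3)]
  note nonneg = hessian_gaussian_convolution_nonneg[OF assms(1-3)]
  have le: "?H x \<preceq>\<^sub>L exp (?\<epsilon> x y) *\<^sub>R ?H y + (sqrt 2 * L * \<delta> / \<rho>) *\<^sub>R mat 1" for x y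
  proof (rule loewner_leI[OF sym sym])
    fix v
    have "sqrt (2 * ln (1 / \<delta>)) \<le> 2 * sqrt (ln (1 / \<delta>))"
      using assms by (simp add: real_sqrt_mult mult_right_mono real_le_lsqrt)
    then have "norm (x - y) * sqrt (2 * ln (1 / \<delta>)) \<le> norm (x - y) * (2 * sqrt (ln (1 / \<delta>)))"
      by (rule mult_left_mono) simp
    moreover have "(norm (x - y))\<^sup>2 / (2 * \<rho>\<^sup>2) \<le> (norm (x - y))\<^sup>2 / \<rho>\<^sup>2"
      using assms by (intro divide_left_mono) auto
    ultimately have "(norm (x - y))\<^sup>2 / (2 * \<rho>\<^sup>2) + norm (x - y) * sqrt (2 * ln (1 / \<delta>)) / \<rho> \<le> ?\<epsilon> x y"
      using assms by (intro add_mono divide_right_mono) (auto simp: mult_ac)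
    then have "exp ((norm (x - y))\<^sup>2 / (2 * \<rho>\<^sup>2) + norm (x - y) * sqrt (2 * ln (1 / \<delta>)) / \<rho>)
        * (v \<bullet> (?H y *v v)) \<le> exp (?\<epsilon> x y) * (v \<bullet> (?H y *v v))"
      by (intro mult_right_mono nonneg) simp
    then show "v \<bullet> (?H x *v v) \<le> exp (?\<epsilon> x y) * (v \<bullet> (?H y *v v)) + sqrt 2 * L * \<delta> / \<rho> * (v \<bullet> v)"
      using hessian_gaussian_convolution_le[OF assms(1-4), of v x y] assms(5) by simp
  qed
  show ?thesis
    using le[of x y] le[of y x] sym nonneg
    by (simp add: is_approximation_def positive_semidefinite_def norm_minus_commute)
qed

end
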